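(* Let $\lambda>0$ be a damping parameter. There exists a binary classification task (a data distribution, a model and a trained parameter) with Gauss-Newton Hessian $H\in\mathbb{R}^{N\times N}$, $\lambda_{\max}(H)>0$, and in-batch Gauss-Newton Hessians $\tilde H_t$ for batches of size $|B|$, such that for every batch size $|B|\ge1$ the exact equality $$\mathbf{E}\tilde H_t^2-H^2=\frac{1}{|B|}\,\mathrm{Tr}(H)\,H$$ holds, and such that for some inputs $\mathbf{u}^0,\mathbf{g}\in\mathbb{R}^N$ the following holds. For any batch size $|B|$ and any step size $\eta$ with $0<\eta\le1/\lambda_{\max}(H)$ such that the matrix $$\left(I-\eta(H+\lambda I)\right)^2+\eta^2\left\{\mathbf{E}\tilde H_t^2-H^2\right\}$$ has an eigenvalue $\mu\ge1$, the LiSSA iterates $\mathbf{u}^t$ with step size $\eta$ converge on average but not samplewise: $$\|\mathbf{E}\mathbf{u}^t-\mathbf{u}^\star\|\to0,\qquad\mathbf{E}\|\mathbf{u}^t-\mathbf{u}^\star\|^2\to\infty\qquad(t\to\infty).$$ In particular, such an $\eta$ exists whenever $$|B|\le\left(\frac{\lambda_{\max}(H)}{\lambda_{\max}(H)+\lambda}\right)^2\frac{\mathrm{Tr}(H)}{\lambda_{\max}(H)}.$$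
   Context: Binary classification task: a distribution of pairs $(\mathbf{x},y)$ with $y\in\{0,1\}$ and a model with logit function $h(\mathbf{x};\theta)\in\mathbb{R}^2$, $\theta\in\mathbb{R}^N$, and class probabilities $\mathrm{sf}(h)$ given by softmax, $\mathrm{sf}(h)_j=\exp(h_j)/\sum_k\exp(h_k)$, evaluated at a trained parameter $\theta$. For a single input let $$G(\mathbf{x})=[J_\theta h(\mathbf{x};\theta)]\left(\mathrm{Diag}(\mathrm{sf}(h))-\mathrm{sf}(h)\mathrm{sf}(h)^\top\right)[J_\theta h(\mathbf{x};\theta)]^\top,\qquad h=h(\mathbf{x};\theta),$$ where $J_\theta h(\mathbf{x};\theta)\in\mathbb{R}^{N\times2}$ has as columns the gradients in $\theta$ of the logits. The Gauss-Newton Hessian is $H=\mathbf{E}\,G(\mathbf{x})$, and the in-batch version at step $t$ is $\tilde H_t=\frac{1}{|B|}\sum_{\mathbf{x}\in B_t}G(\mathbf{x})$, where the batches $B_1,B_2,\dots$ are independent and each consists of $|B|$ i.i.d. draws from the data distribution. LiSSA: given a deterministic start $\mathbf{u}^0$ and vector $\mathbf{g}$, set $\mathbf{u}^{t}=\mathbf{u}^{t-1}-\eta[(\tilde H_t+\lambda I)\mathbf{u}^{t-1}-\mathbf{g}]$ for $t\ge1$; the target is $\mathbf{u}^\star=(H+\lambda I)^{-1}\mathbf{g}$. $\lambda_{\max}(H)$ is the largest eigenvalue and $\|\cdot\|$ the Euclidean norm. *)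

theory Defs
  imports "HOL-Probability.Probability"
begin

section \<open>Eigenvalues\<close>

definition eigenvalue :: "real^'n^'n \<Rightarrow> real \<Rightarrow> bool" where
  "eigenvalue A \<mu> \<longleftrightarrow> (\<exists>v. v \<noteq> 0 \<and> A *v v = \<mu> *\<^sub>R v)"

text \<open>Only used for symmetric matrices, whose set of (real) eigenvalues is finite and nonempty.\<close>

definition lambda_max :: "real^'n^'n \<Rightarrow> real" where
  "lambda_max A = Max {\<mu>. eigenvalue A \<mu>}"

section \<open>Binary classification\<close>

text \<open>
  Labels and logit indices both live in the numeral type \<^typ>\<open>2\<close>, whose elements are 0 and 1.
  A model \<^term>\<open>h\<close> maps an input \<^term>\<open>x\<close> and a parameter \<^term>\<open>\<theta>\<close> to the logit vector;
  the dimension of the parameter space is the cardinality of its index type.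
\<close>

type_synonym ('d, 'n) model = "real^'d \<Rightarrow> real^'n \<Rightarrow> real^2"

type_synonym 'd example = "(real^'d) \<times> 2"

definition softmax :: "real^'k \<Rightarrow> real^'k" where
  "softmax v = (\<chi> j. exp (v $ j) / (\<Sum>k\<in>UNIV. exp (v $ k)))"

definition cross_entropy :: "real^2 \<Rightarrow> 2 \<Rightarrow> real" where
  "cross_entropy v y = - ln (softmax v $ y)"

text \<open>The loss is nonnegative, so its expectation always makes sense in \<^typ>\<open>ennreal\<close>.\<close>

definition risk ::
    "'d example measure \<Rightarrow> ('d::finite, 'n::finite) model \<Rightarrow> real^'n \<Rightarrow> ennreal" where
  "risk D h \<theta> = (\<integral>\<^sup>+(x, y). ennreal (cross_entropy (h x \<theta>) y) \<partial>D)"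

definition softmax_cov :: "real^'k \<Rightarrow> real^'k^'k" where
  "softmax_cov v =
     (\<chi> i j. (if i = j then softmax v $ i else 0) - softmax v $ i * softmax v $ j)"

text \<open>
  \<^term>\<open>jacobian\<close> has the gradients of the logits as rows, hence the transposition.
  Note that on the matrix types \<open>**\<close> is the matrix product and \<^term>\<open>mat c\<close> is \<open>c\<close> times the
  identity, whereas \<open>*\<close>, \<open>^\<close> and \<open>1\<close> would be componentwise.
\<close>

definition param_jacobian ::
    "('d::finite, 'n::finite) model \<Rightarrow> real^'n \<Rightarrow> real^'d \<Rightarrow> real^2^'n" where
  "param_jacobian h \<theta> x = transpose (jacobian (h x) (at \<theta>))"

definition gauss_newton ::
    "('d::finite, 'n::finite) model \<Rightarrow> real^'n \<Rightarrow> real^'d \<Rightarrow> real^'n^'n" where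
  "gauss_newton h \<theta> x =
     param_jacobian h \<theta> x ** softmax_cov (h x \<theta>) ** transpose (param_jacobian h \<theta> x)"

text \<open>
  A data distribution, a model and a trained parameter. ``Trained'' means that \<open>\<theta>\<close> minimises
  the expected cross-entropy loss. The two integrability conditions say that the first and second
  moments of the single-example Gauss-Newton matrices exist, so that every Bochner integral taken
  below is a genuine expectation.
\<close>

definition binary_classification_task ::
    "'d example measure \<Rightarrow> ('d::finite, 'n::finite) model \<Rightarrow> real^'n \<Rightarrow> bool" where
  "binary_classification_task D h \<theta> \<longleftrightarrow>
     prob_space D \<and> sets D = sets (borel \<Otimes>\<^sub>M count_space UNIV) \<and>
     (\<forall>\<theta>'. (\<lambda>x. h x \<theta>') \<in> borel_measurable borel) \<and>
     (\<forall>x. h x differentiable (at \<theta>)) \<and>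
     risk D h \<theta> < \<infinity> \<and> (\<forall>\<theta>'. risk D h \<theta> \<le> risk D h \<theta>') \<and>
     integrable D (\<lambda>(x, y). gauss_newton h \<theta> x) \<and>
     integrable D (\<lambda>(x, y). gauss_newton h \<theta> x ** gauss_newton h \<theta> x)"

definition gn_hessian ::
    "'d example measure \<Rightarrow> ('d::finite, 'n::finite) model \<Rightarrow> real^'n \<Rightarrow> real^'n^'n" where
  "gn_hessian D h \<theta> = (\<integral>(x, y). gauss_newton h \<theta> x \<partial>D)"

section \<open>Batches\<close>

text \<open>
  A batch of size \<open>b\<close> is a function on \<^term>\<open>{..<b}\<close>; \<open>batch D b\<close> is the law of \<open>b\<close> i.i.d. draws
  and \<open>batch_stream D b\<close> the law of a sequence of independent such batches.
\<close>

definition batch :: "'d example measure \<Rightarrow> nat \<Rightarrow> (nat \<Rightarrow> 'd::finite example) measure" where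
  "batch D b = PiM {..<b} (\<lambda>_. D)"

definition batch_stream ::
    "'d example measure \<Rightarrow> nat \<Rightarrow> (nat \<Rightarrow> nat \<Rightarrow> 'd::finite example) measure" where
  "batch_stream D b = PiM UNIV (\<lambda>_. batch D b)"

definition batch_gn ::
    "('d::finite, 'n::finite) model \<Rightarrow> real^'n \<Rightarrow> nat \<Rightarrow> (nat \<Rightarrow> 'd example) \<Rightarrow> real^'n^'n" where
  "batch_gn h \<theta> b z = (1 / real b) *\<^sub>R (\<Sum>i<b. gauss_newton h \<theta> (fst (z i)))"

text \<open>
  The expected square of the in-batch matrix minus the square of its mean. It is
  the same at every step, as all batches have the law \<open>batch D b\<close>.
\<close>

definition batch_gn_var ::
    "'d example measure \<Rightarrow> ('d::finite, 'n::finite) model \<Rightarrow> real^'n \<Rightarrow> nat \<Rightarrow> real^'n^'n" where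
  "batch_gn_var D h \<theta> b =
     (\<integral>z. batch_gn h \<theta> b z ** batch_gn h \<theta> b z \<partial>batch D b) -
     gn_hessian D h \<theta> ** gn_hessian D h \<theta>"

section \<open>LiSSA\<close>

text \<open>\<open>A t\<close> is the matrix used in step \<open>t \<ge> 1\<close>; \<open>A 0\<close> is never used.\<close>

primrec lissa ::
    "(nat \<Rightarrow> real^'n^'n) \<Rightarrow> real \<Rightarrow> real \<Rightarrow> real^'n \<Rightarrow> real^'n \<Rightarrow> nat \<Rightarrow> real^'n" where
  "lissa A lam \<eta> u0 g 0 = u0"
| "lissa A lam \<eta> u0 g (Suc t) =
     lissa A lam \<eta> u0 g t -
     \<eta> *\<^sub>R ((A (Suc t) + mat lam) *v lissa A lam \<eta> u0 g t - g)"

definition lissa_iterate ::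
    "('d::finite, 'n::finite) model \<Rightarrow> real^'n \<Rightarrow> nat \<Rightarrow> real \<Rightarrow> real \<Rightarrow> real^'n \<Rightarrow> real^'n \<Rightarrow>
      nat \<Rightarrow> (nat \<Rightarrow> nat \<Rightarrow> 'd example) \<Rightarrow> real^'n" where
  "lissa_iterate h \<theta> b lam \<eta> u0 g t \<omega> =
     lissa (\<lambda>s. batch_gn h \<theta> b (\<omega> s)) lam \<eta> u0 g t"

definition lissa_target :: "real^'n^'n \<Rightarrow> real \<Rightarrow> real^'n \<Rightarrow> real^'n" where
  "lissa_target H lam g = matrix_inv (H + mat lam) *v g"

text \<open>The matrix whose eigenvalues govern the growth of the mean squared error of the iterates.\<close>

definition msq_matrix ::
    "'d example measure \<Rightarrow> ('d::finite, 'n::finite) model \<Rightarrow> real^'n \<Rightarrow> nat \<Rightarrow>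
      real \<Rightarrow> real \<Rightarrow> real^'n^'n" where
  "msq_matrix D h \<theta> b lam \<eta> =
     (mat 1 - \<eta> *\<^sub>R (gn_hessian D h \<theta> + mat lam)) ** (mat 1 - \<eta> *\<^sub>R (gn_hessian D h \<theta> + mat lam)) +
     \<eta>\<^sup>2 *\<^sub>R batch_gn_var D h \<theta> b"

end

theory Submission
  imports Defs
begin

text \<open>
  With \<open>N\<close> parameters, let the logit difference at input number \<open>j \<le> N\<close> depend on the \<open>j\<close>-th
  parameter only, and let one further input have no features. If the input is uniform and the label
  a fair coin, the zero parameter is optimal, and \<open>G(x) = s e\<^sub>j e\<^sub>j\<^sup>T\<close> or \<open>0\<close>, each with probability
  \<open>1 / (N + 1)\<close>. Then \<open>H = a I\<close> with \<open>a = s / (N + 1)\<close>, and \<open>E G\<^sup>2 = s a I = (N + 1) a\<^sup>2 I =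
  H\<^sup>2 + Tr(H) H\<close>; the featureless input is there to make this exact.

  All matrices are diagonal, so each coordinate of the LiSSA error satisfies a scalar recursion
  \<open>e' = (1 - \<eta> (X + \<lambda>)) e - \<eta> (X - a)\<close> with \<open>X\<close> independent of \<open>e\<close>, of mean \<open>a\<close> and variance
  \<open>v = N a\<^sup>2 / b\<close>; here the target is the all-ones vector. Hence \<open>E e\<close> is multiplied by
  \<open>\<rho> = 1 - \<eta> (a + \<lambda>)\<close>, while \<open>E e\<^sup>2\<close> becomes \<open>\<mu> E e\<^sup>2 + \<eta>\<^sup>2 v (1 + 2 E e)\<close> with
  \<open>\<mu> = \<rho>\<^sup>2 + \<eta>\<^sup>2 v\<close> the only eigenvalue of the mean-square matrix. The choice \<open>a = 2 \<lambda>\<close> gives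
  \<open>\<bar>\<rho>\<bar> < 1\<close> for all admissible \<open>\<eta>\<close>, so \<open>E e \<rightarrow> 0\<close>; and if \<open>\<mu> \<ge> 1\<close>, the additive noise, which
  does not vanish because the target is nonzero, makes \<open>E e\<^sup>2\<close> grow at least linearly, even when
  \<open>\<mu> = 1\<close>.
\<close>

section \<open>Independence and moments of a scalar iteration\<close>

text \<open>Independence amounts to the joint law being the product of the marginals. Here the joint
  map is restriction to \<open>I\<close>, which is the identity on the product space.\<close>

lemma indep_vars_PiM_components:
  assumes "I \<noteq> {}" "\<And>i. i \<in> I \<Longrightarrow> prob_space (M i)"
  shows "prob_space.indep_vars (PiM I M) M (\<lambda>i \<omega>. \<omega> i) I"
proof -
  interpret prob_space "PiM I M"
    using assms(2) by (rule prob_space_PiM)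
  have "distr (PiM I M) (PiM I M) (\<lambda>x. \<lambda>i\<in>I. x i) = distr (PiM I M) (PiM I M) (\<lambda>x. x)"
    by (intro distr_cong) (auto simp: space_PiM PiE_def extensional_restrict)
  also have "\<dots> = PiM I (\<lambda>i. distr (PiM I M) (M i) (\<lambda>\<omega>. \<omega> i))"
    using assms(2) by (auto simp: distr_id2 distr_PiM_component intro!: PiM_cong)
  finally show ?thesis
    using assms(1) by (subst indep_vars_iff_distr_eq_PiM') auto
qed

text \<open>In the expanded square each of the \<open>b * b\<close> products contributes
  \<open>m\<^sup>2\<close>, off the diagonal by pairwise independence; the \<open>b\<close> diagonal
  ones add the variance \<open>q - m\<^sup>2\<close>. After division by
  \<open>(real b)\<^sup>2\<close> the variance carries the factor \<open>1 / b\<close>.\<close>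

lemma (in prob_space) second_moment_mean_iid:
  fixes X :: "nat \<Rightarrow> 'a \<Rightarrow> real"
  assumes ind: "indep_vars (\<lambda>_. borel) X {..<b}"
    and int: "\<And>i. i < b \<Longrightarrow> integrable M (X i)" "\<And>i. i < b \<Longrightarrow> integrable M (\<lambda>\<omega>. (X i \<omega>)\<^sup>2)"
    and m: "\<And>i. i < b \<Longrightarrow> expectation (X i) = m"
    and q: "\<And>i. i < b \<Longrightarrow> expectation (\<lambda>\<omega>. (X i \<omega>)\<^sup>2) = q"
    and "b > 0"
  shows "expectation (\<lambda>\<omega>. ((\<Sum>i<b. X i \<omega>) / b)\<^sup>2) = m\<^sup>2 + (q - m\<^sup>2) / b"
proof -
  have prod: "integrable M (\<lambda>\<omega>. X i \<omega> * X k \<omega>) \<and>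
      expectation (\<lambda>\<omega>. X i \<omega> * X k \<omega>) = (if k = i then q - m\<^sup>2 else 0) + m\<^sup>2"
    if "i < b" "k < b" for i k
  proof (cases "i = k")
    case True
    then show ?thesis using int(2) q that by (simp add: power2_eq_square)
  next
    case False
    have pair: "finite {i, k}" "indep_vars (\<lambda>_. borel) X {i, k}" "\<And>j. j \<in> {i, k} \<Longrightarrow> integrable M (X j)"
      using ind int(1) that by (auto intro: indep_vars_subset)
    from indep_vars_integrable[OF pair] indep_vars_lebesgue_integral[OF pair] show ?thesis
      using False m that by (simp add: power2_eq_square)
  qed
  have "expectation (\<lambda>\<omega>. ((\<Sum>i<b. X i \<omega>) / b)\<^sup>2) =
      expectation (\<lambda>\<omega>. (\<Sum>i<b. \<Sum>k<b. X i \<omega> * X k \<omega>) / (real b)\<^sup>2)"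
    by (simp add: power_divide power2_eq_square sum_product)
  also have "\<dots> = (\<Sum>i<b. expectation (\<lambda>\<omega>. \<Sum>k<b. X i \<omega> * X k \<omega>)) / (real b)\<^sup>2"
    using prod by (subst Bochner_Integration.integral_divide_zero, subst Bochner_Integration.integral_sum) auto
  also have "\<dots> = (\<Sum>i<b. \<Sum>k<b. expectation (\<lambda>\<omega>. X i \<omega> * X k \<omega>)) / (real b)\<^sup>2"
    using prod by (intro arg_cong2[of _ _ _ _ "(/)"] sum.cong Bochner_Integration.integral_sum) auto
  also have "\<dots> = (\<Sum>i<b. \<Sum>k<b. (if k = i then q - m\<^sup>2 else 0) + m\<^sup>2) / (real b)\<^sup>2"
    using prod by simp
  also have "\<dots> = m\<^sup>2 + (q - m\<^sup>2) / b"
    using \<open>b > 0\<close> by (simp add: sum.distrib field_simps power2_eq_square)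
  finally show ?thesis .
qed

text \<open>Error of a scalar iteration with mean curvature \<open>a\<close> and target 1, driven by \<open>x 1, x 2, \<dots>\<close>;
  as in the LiSSA iteration, \<open>x 0\<close> is never used.\<close>

primrec lissa_error :: "real \<Rightarrow> real \<Rightarrow> real \<Rightarrow> (nat \<Rightarrow> real) \<Rightarrow> real \<Rightarrow> nat \<Rightarrow> real" where
  "lissa_error a lam \<eta> x e 0 = e"
| "lissa_error a lam \<eta> x e (Suc t) =
     (1 - \<eta> * (x (Suc t) + lam)) * lissa_error a lam \<eta> x e t - \<eta> * (x (Suc t) - a)"

text \<open>Adaptedness: it allows the error at time \<open>t\<close> to be computed from the
  process restricted to \<open>{..t}\<close>.\<close>

lemma lissa_error_cong:
  "(\<And>i. i \<le> t \<Longrightarrow> x i = y i) \<Longrightarrow> lissa_error a lam \<eta> x e t = lissa_error a lam \<eta> y e t"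
  by (induction t) simp_all

lemma measurable_lissa_error_PiM:
  "t \<le> n \<Longrightarrow> (\<lambda>x. lissa_error a lam \<eta> x e t) \<in> borel_measurable (PiM {..n} (\<lambda>_. borel))"
  by (induction t) simp_all

context prob_space
begin

context
  fixes X :: "nat \<Rightarrow> 'a \<Rightarrow> real" and a lam \<eta> v e :: real
  assumes ind: "indep_vars (\<lambda>_. borel) X UNIV"
    and int: "\<And>t. integrable M (X t)" "\<And>t. integrable M (\<lambda>\<omega>. (X t \<omega>)\<^sup>2)"
    and mean: "\<And>t. expectation (X t) = a"
    and second: "\<And>t. expectation (\<lambda>\<omega>. (X t \<omega>)\<^sup>2) = a\<^sup>2 + v"
begin

abbreviation (input) err where
  "err t \<omega> \<equiv> lissa_error a lam \<eta> (\<lambda>s. X s \<omega>) e t"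

text \<open>The error at time \<open>t\<close> uses indices up to \<open>t\<close> and the next draw
  has index \<open>Suc t\<close>, so the two are functions of disjoint blocks of an independent
  family. General \<open>f\<close> and \<open>g\<close> cover polynomials in the draw against both
  the error and its square.\<close>

lemma indep_lissa_error:
  assumes [measurable]: "f \<in> borel_measurable borel" "g \<in> borel_measurable borel"
  shows "indep_var borel (\<lambda>\<omega>. f (X (Suc t) \<omega>) :: real) borel (\<lambda>\<omega>. g (err t \<omega>) :: real)"
proof -
  have "indep_var borel ((\<lambda>x. f (x (Suc t))) \<circ> (\<lambda>\<omega>. restrict (\<lambda>i. X i \<omega>) {Suc t}))
    borel ((\<lambda>x. g (lissa_error a lam \<eta> x e t)) \<circ> (\<lambda>\<omega>. restrict (\<lambda>i. X i \<omega>) {..t}))"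
    using measurable_lissa_error_PiM[measurable]
    by (intro indep_var_compose[OF indep_var_restrict[OF ind]]) auto
  also have "(\<lambda>x. g (lissa_error a lam \<eta> x e t)) \<circ> (\<lambda>\<omega>. restrict (\<lambda>i. X i \<omega>) {..t}) =
      (\<lambda>\<omega>. g (err t \<omega>))"
    by (auto simp: fun_eq_iff intro!: arg_cong[of _ _ g] lissa_error_cong)
  finally show ?thesis by (simp add: comp_def)
qed

text \<open>The new error and its square are polynomials in the old error whose coefficients are
  polynomials in the fresh draw; by independence the expectation of each term factorizes. The cross
  term leaves only \<open>2 * \<eta>\<^sup>2 * v\<close> times the mean error, as the draw enters
  the noise centred at \<open>a\<close>.\<close>

lemma lissa_error_moments_Suc:
  assumes e1: "integrable M (err t)" and e2: "integrable M (\<lambda>\<omega>. (err t \<omega>)\<^sup>2)"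
  shows "integrable M (err (Suc t))" "integrable M (\<lambda>\<omega>. (err (Suc t) \<omega>)\<^sup>2)"
    and "expectation (err (Suc t)) = (1 - \<eta> * (a + lam)) * expectation (err t)"
    and "expectation (\<lambda>\<omega>. (err (Suc t) \<omega>)\<^sup>2) =
      ((1 - \<eta> * (a + lam))\<^sup>2 + \<eta>\<^sup>2 * v) * expectation (\<lambda>\<omega>. (err t \<omega>)\<^sup>2) +
      \<eta>\<^sup>2 * v * (1 + 2 * expectation (err t))"
proof -
  let ?X = "X (Suc t)"
  \<comment> \<open>Every coefficient has degree at most 2 in the draw, so one quadratic template
    serves for all terms.\<close>
  have polyint: "integrable M (\<lambda>\<omega>. \<alpha> + \<beta> * ?X \<omega> + \<gamma> * (?X \<omega>)\<^sup>2)" for \<alpha> \<beta> \<gamma>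
    using int by simp
  have polyE: "expectation (\<lambda>\<omega>. \<alpha> + \<beta> * ?X \<omega> + \<gamma> * (?X \<omega>)\<^sup>2) = \<alpha> + \<beta> * a + \<gamma> * (a\<^sup>2 + v)" for \<alpha> \<beta> \<gamma>
    using int mean second by (simp add: prob_space)
  have e_int: "integrable M (\<lambda>\<omega>. (\<alpha> + \<beta> * ?X \<omega> + \<gamma> * (?X \<omega>)\<^sup>2) * err t \<omega>)" for \<alpha> \<beta> \<gamma>
    by (rule indep_var_integrable[OF indep_lissa_error[of "\<lambda>x. \<alpha> + \<beta> * x + \<gamma> * x\<^sup>2" "\<lambda>x. x"] polyint e1]) measurable
  have e_E: "expectation (\<lambda>\<omega>. (\<alpha> + \<beta> * ?X \<omega> + \<gamma> * (?X \<omega>)\<^sup>2) * err t \<omega>) =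
      (\<alpha> + \<beta> * a + \<gamma> * (a\<^sup>2 + v)) * expectation (\<lambda>\<omega>. err t \<omega>)" for \<alpha> \<beta> \<gamma>
    unfolding polyE[symmetric]
    by (rule indep_var_lebesgue_integral[OF indep_lissa_error[of "\<lambda>x. \<alpha> + \<beta> * x + \<gamma> * x\<^sup>2" "\<lambda>x. x"] polyint e1]) measurable
  have e2_int: "integrable M (\<lambda>\<omega>. (\<alpha> + \<beta> * ?X \<omega> + \<gamma> * (?X \<omega>)\<^sup>2) * (err t \<omega>)\<^sup>2)" for \<alpha> \<beta> \<gamma>
    by (rule indep_var_integrable[OF indep_lissa_error[of "\<lambda>x. \<alpha> + \<beta> * x + \<gamma> * x\<^sup>2" "\<lambda>x. x\<^sup>2"] polyint e2]) measurable
  have e2_E: "expectation (\<lambda>\<omega>. (\<alpha> + \<beta> * ?X \<omega> + \<gamma> * (?X \<omega>)\<^sup>2) * (err t \<omega>)\<^sup>2) =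
      (\<alpha> + \<beta> * a + \<gamma> * (a\<^sup>2 + v)) * expectation (\<lambda>\<omega>. (err t \<omega>)\<^sup>2)" for \<alpha> \<beta> \<gamma>
    unfolding polyE[symmetric]
    by (rule indep_var_lebesgue_integral[OF indep_lissa_error[of "\<lambda>x. \<alpha> + \<beta> * x + \<gamma> * x\<^sup>2" "\<lambda>x. x\<^sup>2"] polyint e2]) measurable
  \<comment> \<open>Unlike the contraction factor \<open>1 - \<eta> * (a + lam)\<close>, this
    \<open>\<rho>\<close> leaves out \<open>a\<close>, because the draw itself stays as the
    polynomial variable. The zero quadratic terms in \<open>s1\<close> fit its coefficients to the
    template.\<close>
  define \<rho> where "\<rho> = 1 - \<eta> * lam"
  have s1: "err (Suc t) \<omega> = (\<rho> + (- \<eta>) * ?X \<omega> + 0 * (?X \<omega>)\<^sup>2) * err t \<omega>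
      + (\<eta> * a + (- \<eta>) * ?X \<omega> + 0 * (?X \<omega>)\<^sup>2)" for \<omega>
    by (simp add: \<rho>_def algebra_simps)
  have s2: "(err (Suc t) \<omega>)\<^sup>2 =
      (\<rho>\<^sup>2 + (- 2 * \<rho> * \<eta>) * ?X \<omega> + \<eta>\<^sup>2 * (?X \<omega>)\<^sup>2) * (err t \<omega>)\<^sup>2
      + (2 * \<rho> * \<eta> * a + (- 2 * \<rho> * \<eta> - 2 * \<eta>\<^sup>2 * a) * ?X \<omega> + 2 * \<eta>\<^sup>2 * (?X \<omega>)\<^sup>2) * err t \<omega>
      + ((\<eta> * a)\<^sup>2 + (- 2 * \<eta>\<^sup>2 * a) * ?X \<omega> + \<eta>\<^sup>2 * (?X \<omega>)\<^sup>2)" for \<omega>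
    unfolding s1 by (simp add: power2_eq_square algebra_simps)
  show "integrable M (err (Suc t))"
    unfolding s1 by (intro Bochner_Integration.integrable_add e_int polyint)
  show "integrable M (\<lambda>\<omega>. (err (Suc t) \<omega>)\<^sup>2)"
    unfolding s2 by (intro Bochner_Integration.integrable_add e_int e2_int polyint)
  show "expectation (err (Suc t)) = (1 - \<eta> * (a + lam)) * expectation (err t)"
    unfolding s1 Bochner_Integration.integral_add[OF e_int polyint] e_E polyE
    by (simp add: \<rho>_def algebra_simps)
  show "expectation (\<lambda>\<omega>. (err (Suc t) \<omega>)\<^sup>2) =
      ((1 - \<eta> * (a + lam))\<^sup>2 + \<eta>\<^sup>2 * v) * expectation (\<lambda>\<omega>. (err t \<omega>)\<^sup>2) +
      \<eta>\<^sup>2 * v * (1 + 2 * expectation (err t))"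
    unfolding s2 Bochner_Integration.integral_add[OF Bochner_Integration.integrable_add[OF e2_int e_int] polyint]
      Bochner_Integration.integral_add[OF e2_int e_int] e_E e2_E polyE
    by (simp add: \<rho>_def power2_eq_square algebra_simps)
qed

lemma integrable_lissa_error:
  "integrable M (err t)" "integrable M (\<lambda>\<omega>. (err t \<omega>)\<^sup>2)"
  by (induction t) (simp_all del: lissa_error.simps(2) add: lissa_error_moments_Suc)

lemma expectation_lissa_error: "expectation (err t) = (1 - \<eta> * (a + lam)) ^ t * e"
  by (induction t)
    (simp_all del: lissa_error.simps(2)
      add: lissa_error_moments_Suc(3) integrable_lissa_error prob_space)

lemma second_moment_lissa_error_at_top:
  assumes contr: "\<bar>1 - \<eta> * (a + lam)\<bar> < 1" and "\<eta> \<noteq> 0" "v > 0"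
    and grow: "(1 - \<eta> * (a + lam))\<^sup>2 + \<eta>\<^sup>2 * v \<ge> 1"
  shows "filterlim (\<lambda>t. expectation (\<lambda>\<omega>. (err t \<omega>)\<^sup>2)) at_top sequentially"
proof -
  define E2 where "E2 t = expectation (\<lambda>\<omega>. (err t \<omega>)\<^sup>2)" for t
  \<comment> \<open>Half of the noise \<open>\<eta>\<^sup>2 * v\<close>: once the mean error exceeds
    \<open>- 1 / 4\<close>, the factor \<open>1 + 2 * expectation (err t)\<close> is at least
    1/2.\<close>
  let ?K = "\<eta>\<^sup>2 * v / 2"
  have "?K > 0" using assms by simp
  have E2_nonneg: "E2 t \<ge> 0" for t by (simp add: E2_def)
  have "(\<lambda>t. (1 - \<eta> * (a + lam)) ^ t * e) \<longlonglongrightarrow> 0 * e"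
    using contr by (intro tendsto_intros LIMSEQ_power_zero) auto
  then have "\<forall>\<^sub>F t in sequentially. (1 - \<eta> * (a + lam)) ^ t * e > - 1 / 4"
    by (intro order_tendstoD(1)[of _ 0]) auto
  then obtain T where T: "\<And>t. t \<ge> T \<Longrightarrow> (1 - \<eta> * (a + lam)) ^ t * e > - 1 / 4"
    by (auto simp: eventually_sequentially)
  have growth: "E2 (Suc t) \<ge> E2 t + ?K" if "t \<ge> T" for t
  proof -
    have "1 * E2 t \<le> ((1 - \<eta> * (a + lam))\<^sup>2 + \<eta>\<^sup>2 * v) * E2 t"
      by (rule mult_right_mono[OF grow E2_nonneg])
    moreover have "\<eta>\<^sup>2 * v * (1 / 2) \<le> \<eta>\<^sup>2 * v * (1 + 2 * ((1 - \<eta> * (a + lam)) ^ t * e))"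
      using T[OF that] assms by (intro mult_left_mono) auto
    ultimately show ?thesis
      unfolding E2_def lissa_error_moments_Suc(4)[OF integrable_lissa_error] expectation_lissa_error
      by simp
  qed
  \<comment> \<open>The increments are summed from \<open>T\<close> on, with nonnegativity of
    \<open>E2 T\<close> as the start.\<close>
  have lin: "- (real T * ?K) + real t * ?K \<le> E2 t" if "t \<ge> T" for t
    using that
  proof (induction t rule: dec_induct)
    case (step n)
    then show ?case using growth[of n] by (simp add: algebra_simps)
  qed (simp add: E2_nonneg)
  have "filterlim (\<lambda>t. - (real T * ?K) + real t * ?K) at_top sequentially"
    by (intro filterlim_tendsto_add_at_top[OF tendsto_const]
      filterlim_at_top_mult_tendsto_pos[OF tendsto_const \<open>?K > 0\<close>] filterlim_real_sequentially)
  then show ?thesis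
    unfolding E2_def[symmetric]
    by (rule filterlim_at_top_mono) (use lin in \<open>auto simp: eventually_sequentially\<close>)
qed

end

end

section \<open>Diagonal matrices\<close>

lemma bounded_linear_axis: "bounded_linear (axis j :: 'b::euclidean_space \<Rightarrow> 'b^'n::finite)"
  unfolding linear_conv_bounded_linear[symmetric]
  by (rule linearI) (auto simp: axis_def vec_eq_iff)

text \<open>A vector is the sum of its coordinates embedded along the axes. Entries may themselves
  be vectors, so two applications, to rows and then to the whole, handle matrices.\<close>

lemma integrable_vecI:
  fixes f :: "'a \<Rightarrow> 'b::euclidean_space^'n::finite"
  assumes "\<And>j. integrable M (\<lambda>\<omega>. f \<omega> $ j)"
  shows "integrable M f"
proof -
  have "integrable M (\<lambda>\<omega>. \<Sum>j\<in>UNIV. axis j (f \<omega> $ j))"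
    using assms by (intro Bochner_Integration.integrable_sum integrable_bounded_linear[OF bounded_linear_axis])
  also have "(\<lambda>\<omega>. \<Sum>j\<in>UNIV. axis j (f \<omega> $ j)) = f"
    by (auto simp: vec_eq_iff axis_def fun_eq_iff)
  finally show ?thesis .
qed

lemma integral_vec_nth:
  fixes f :: "'a \<Rightarrow> 'b::euclidean_space^'n::finite"
  assumes "integrable M f"
  shows "(\<integral>\<omega>. f \<omega> \<partial>M) $ j = (\<integral>\<omega>. f \<omega> $ j \<partial>M)"
  using integral_bounded_linear[OF bounded_linear_vec_nth assms, of j] by simp

definition diag_mat :: "('n \<Rightarrow> real) \<Rightarrow> real^'n^'n" where
  "diag_mat v = (\<chi> p q. if p = q then v p else 0)"

lemma diag_mat_mult: "diag_mat u ** diag_mat v = diag_mat (\<lambda>j. u j * v j :: real)"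
  for u v :: "'n::finite \<Rightarrow> real"
  by (simp add: diag_mat_def matrix_matrix_mult_def vec_eq_iff if_distrib[of "\<lambda>x. x * _"] cong: if_cong)

lemma diag_mat_vector_mult: "(diag_mat v *v u) $ j = v j * u $ j" for v :: "'n::finite \<Rightarrow> real"
  by (simp add: diag_mat_def matrix_vector_mult_def if_distrib[of "\<lambda>x. x * _"] cong: if_cong)

lemma scaleR_diag_mat: "c *\<^sub>R diag_mat v = diag_mat (\<lambda>j. c * v j)"
  by (simp add: diag_mat_def vec_eq_iff)

lemma diag_mat_sum: "(\<Sum>i\<in>I. diag_mat (v i)) = diag_mat (\<lambda>j. \<Sum>i\<in>I. v i j)"
  by (induction I rule: infinite_finite_induct) (auto simp: diag_mat_def vec_eq_iff)

lemma mat_eq_diag_mat: "mat c = diag_mat (\<lambda>_. c)"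
  by (simp add: mat_def diag_mat_def)

lemma diag_mat_add: "diag_mat u + diag_mat v = diag_mat (\<lambda>j. u j + v j)"
  and diag_mat_diff: "diag_mat u - diag_mat v = diag_mat (\<lambda>j. u j - v j)"
  by (simp_all add: diag_mat_def vec_eq_iff)

lemmas mat_algebra = mat_eq_diag_mat scaleR_diag_mat diag_mat_add diag_mat_diff diag_mat_mult

lemma integral_diag_mat:
  fixes f :: "'a \<Rightarrow> 'n::finite \<Rightarrow> real"
  assumes "\<And>j. integrable M (\<lambda>\<omega>. f \<omega> j)"
  shows "integrable M (\<lambda>\<omega>. diag_mat (f \<omega>))"
    and "(\<integral>\<omega>. diag_mat (f \<omega>) \<partial>M) = diag_mat (\<lambda>j. \<integral>\<omega>. f \<omega> j \<partial>M)"
proof -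
  have entry: "integrable M (\<lambda>\<omega>. diag_mat (f \<omega>) $ p $ q)" for p q
    using assms by (cases "p = q") (auto simp: diag_mat_def)
  then have row: "integrable M (\<lambda>\<omega>. diag_mat (f \<omega>) $ p)" for p
    by (rule integrable_vecI)
  then show int: "integrable M (\<lambda>\<omega>. diag_mat (f \<omega>))"
    by (rule integrable_vecI)
  have "(\<integral>\<omega>. diag_mat (f \<omega>) \<partial>M) $ p $ q = diag_mat (\<lambda>j. \<integral>\<omega>. f \<omega> j \<partial>M) $ p $ q" for p q
    by (simp add: integral_vec_nth int row) (simp add: diag_mat_def)
  then show "(\<integral>\<omega>. diag_mat (f \<omega>) \<partial>M) = diag_mat (\<lambda>j. \<integral>\<omega>. f \<omega> j \<partial>M)"
    by (simp add: vec_eq_iff)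
qed

section \<open>Spectrum, trace and LiSSA target of scalar matrices\<close>

lemma eigenvalue_mat_iff: "eigenvalue (mat c :: real^'n::finite^'n) \<mu> \<longleftrightarrow> \<mu> = c"
proof
  assume "\<mu> = c"
  moreover have "mat c *v (1 :: real^'n) = c *\<^sub>R 1"
    by (simp add: vec_eq_iff mat_eq_diag_mat diag_mat_vector_mult)
  ultimately show "eigenvalue (mat c :: real^'n^'n) \<mu>"
    unfolding eigenvalue_def by (intro exI[of _ 1]) simp
next
  assume "eigenvalue (mat c :: real^'n^'n) \<mu>"
  then obtain v :: "real^'n" where "v \<noteq> 0" "mat c *v v = \<mu> *\<^sub>R v"
    by (auto simp: eigenvalue_def)
  moreover from this obtain j where "v $ j \<noteq> 0" by (auto simp: vec_eq_iff)
  ultimately show "\<mu> = c"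
    by (auto simp: vec_eq_iff mat_eq_diag_mat diag_mat_vector_mult)
qed

lemma lambda_max_mat: "lambda_max (mat c :: real^'n::finite^'n) = c"
  by (simp add: lambda_max_def eigenvalue_mat_iff)

lemma trace_mat: "trace (mat c :: real^'n::finite^'n) = real CARD('n) * c"
  by (simp add: trace_def mat_def)

text \<open>Scaling the right-hand side by \<open>a + lam\<close> makes any chosen vector
  \<open>u\<close> the target.\<close>

lemma lissa_target_mat:
  assumes "a + lam \<noteq> 0"
  shows "lissa_target (mat a :: real^'n::finite^'n) lam ((a + lam) *\<^sub>R u) = u"
proof -
  let ?A = "mat a + mat lam :: real^'n^'n"
  have "?A ** mat (1 / (a + lam)) = mat 1" "mat (1 / (a + lam)) ** ?A = mat 1"
    using assms by (simp_all add: mat_algebra)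
  \<comment> \<open>\<open>matrix_inv\<close> chooses some two-sided inverse; the explicit scalar
    one shows that the choice is not void.\<close>
  then have "matrix_inv ?A ** ?A = mat 1"
    unfolding matrix_inv_def by - (rule someI2[of _ "mat (1 / (a + lam))"], auto)
  moreover have "(a + lam) *\<^sub>R u = ?A *v u"
    by (simp add: vec_eq_iff mat_algebra diag_mat_vector_mult)
  ultimately show ?thesis
    by (simp add: lissa_target_def matrix_vector_mul_assoc)
qed

section \<open>The one-hot task\<close>

text \<open>Injective, so that \<open>None\<close> and \<open>Some j\<close> are distinct inputs even in dimension 1.\<close>

definition one_hot_input :: "'n::finite option \<Rightarrow> real^'d::finite" where
  "one_hot_input i = vec (real (to_nat i))"

definition hit :: "'n::finite \<Rightarrow> real^'d::finite \<Rightarrow> real" where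
  "hit j = indicator {one_hot_input (Some j)}"

definition feature :: "real^'d::finite \<Rightarrow> real^'n::finite" where
  "feature x = (\<chi> j. hit j x)"

text \<open>Only logit 0 varies. The factor \<open>2 * sqrt s\<close> has square
  \<open>4 * s\<close>, which cancels the softmax variance 1/4 at zero logits and leaves
  \<open>s\<close>.\<close>

definition one_hot_model :: "real \<Rightarrow> ('d::finite, 'n::finite) model" where
  "one_hot_model s x \<theta> = (2 * sqrt s * (\<theta> \<bullet> feature x)) *\<^sub>R axis 0 1"

text \<open>\<open>None\<close> indexes the featureless input. The discrete law of index and label
  is pushed forward to the Borel product space on which tasks are defined.\<close>

definition one_hot_law :: "'n::finite itself \<Rightarrow> 'd::finite example measure" where
  "one_hot_law _ = distr (pair_pmf (pmf_of_set (UNIV :: 'n option set)) (pmf_of_set UNIV))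
     (borel \<Otimes>\<^sub>M count_space UNIV) (\<lambda>(i, y). (one_hot_input i, y))"

lemma one_hot_input_eq_iff: "(one_hot_input i :: real^'d::finite) = one_hot_input k \<longleftrightarrow> i = k"
  by (simp add: one_hot_input_def vec_eq_iff)

lemma hit_measurable [measurable]: "hit j \<in> borel_measurable borel"
  unfolding hit_def by measurable

lemma hit_bounds: "0 \<le> hit j x" "hit j x \<le> 1"
  by (simp_all add: hit_def indicator_def)

text \<open>An input hits at most one coordinate, since the inputs are distinct; this makes every
  Gauss-Newton matrix diagonal.\<close>

lemma hit_mult_hit: "hit j x * hit k x = (if j = k then hit j x else 0)"
  by (auto simp: hit_def indicator_def one_hot_input_eq_iff)

lemma hit_square: "(hit j x)\<^sup>2 = hit j x"
  by (simp add: hit_def indicator_def)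

section \<open>Integrals under the one-hot law\<close>

lemma prob_space_one_hot_law: "prob_space (one_hot_law TYPE('n::finite) :: 'd::finite example measure)"
  unfolding one_hot_law_def by (intro measure_pmf.prob_space_distr) (auto simp: space_pair_measure)

lemma sets_one_hot_law [measurable_cong]:
  "sets (one_hot_law TYPE('n::finite) :: 'd::finite example measure) = sets (borel \<Otimes>\<^sub>M count_space UNIV)"
  by (simp add: one_hot_law_def)

lemma integrable_hit:
  "integrable (one_hot_law TYPE('n) :: 'd::finite example measure) (\<lambda>z. c * hit (j :: 'n::finite) (fst z))"
proof -
  interpret prob_space "one_hot_law TYPE('n) :: 'd example measure"
    by (rule prob_space_one_hot_law)
  show ?thesis
    by (rule integrable_const_bound[where B = "\<bar>c\<bar>"])
      (auto simp: abs_mult hit_bounds intro!: mult_left_le)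
qed

lemma integral_hit:
  "(\<integral>z. hit (j :: 'n::finite) (fst z) \<partial>(one_hot_law TYPE('n) :: 'd::finite example measure)) =
     1 / (real CARD('n) + 1)"
proof -
  have "(\<integral>z. hit j (fst z) \<partial>(one_hot_law TYPE('n) :: 'd example measure)) =
    measure_pmf.expectation (pair_pmf (pmf_of_set (UNIV :: 'n option set)) (pmf_of_set (UNIV :: 2 set)))
      (\<lambda>z. hit j (one_hot_input (fst z) :: real^'d))"
    unfolding one_hot_law_def by (subst integral_distr) (auto simp: case_prod_beta space_pair_measure)
  also have "\<dots> = (\<Sum>i\<in>(UNIV :: 'n option set). hit j (one_hot_input i :: real^'d)) / real CARD('n option)"
    by (subst expectation_pair_pmf_fst) (simp add: integral_pmf_of_set)
  also have "(\<Sum>i\<in>(UNIV :: 'n option set). hit j (one_hot_input i :: real^'d)) = (\<Sum>i\<in>UNIV. if i = Some j then 1 else 0)"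
    by (intro sum.cong) (auto simp: hit_def one_hot_input_eq_iff)
  finally show ?thesis by (simp add: card_UNIV_option)
qed

section \<open>Gauss-Newton matrices at the zero parameter\<close>

lemma softmax_cov_0: "softmax_cov (0 :: real^2) $ 0 $ 0 = 1 / 4"
  by (simp add: softmax_cov_def softmax_def)

lemma one_hot_model_has_derivative:
  "(one_hot_model s x has_derivative one_hot_model s x) (at \<theta>)"
  unfolding one_hot_model_def by (auto intro!: derivative_eq_intros)

lemma one_hot_model_0: "one_hot_model s x 0 = 0"
  by (simp add: one_hot_model_def)

text \<open>Logit 1 has zero gradient, so only the entry \<open>$ 0 $ 0\<close> of the softmax
  covariance enters, and the matrix is \<open>s\<close> times the outer product of the feature
  vector with itself.\<close>

lemma gauss_newton_one_hot_model:
  assumes "s \<ge> 0"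
  shows "gauss_newton (one_hot_model s) 0 x = diag_mat (\<lambda>j. s * hit j x)"
proof -
  have J: "param_jacobian (one_hot_model s) 0 x = (\<chi> j k. if k = 0 then 2 * sqrt s * hit j x else 0)"
    unfolding param_jacobian_def jacobian_def frechet_derivative_at[OF one_hot_model_has_derivative, symmetric]
    by (simp add: vec_eq_iff transpose_def matrix_def one_hot_model_def inner_axis' feature_def)
      (simp add: axis_def)
  have entry: "gauss_newton (one_hot_model s) 0 x $ p $ q = s * (hit p x * hit q x)" for p q
    unfolding gauss_newton_def J one_hot_model_0
    using assms
    by (simp add: matrix_matrix_mult_def transpose_def if_distrib[of "\<lambda>x. x * _"]
        if_distrib[of "\<lambda>x. _ * x"] softmax_cov_0 cong: if_cong)
  show ?thesis
    by (simp add: vec_eq_iff entry diag_mat_def hit_mult_hit)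
qed

section \<open>Optimality of the zero parameter\<close>

lemma UNIV_2_eq: "(UNIV :: 2 set) = {0, 1}"
  using UNIV_2 by auto

text \<open>With logits \<open>r\<close> and 0 the cross-entropy is the logistic loss in the logit
  difference \<open>r\<close>.\<close>

lemma cross_entropy_one_hot_model:
  "cross_entropy (one_hot_model s x \<theta>) y =
     ln (1 + exp (2 * sqrt s * (\<theta> \<bullet> feature x))) - (if y = 0 then 2 * sqrt s * (\<theta> \<bullet> feature x) else 0)"
proof -
  have "(1 :: 2) \<noteq> 0" by simp
  moreover have "1 + exp r \<noteq> 0" for r :: real
    using exp_gt_zero[of r] by linarith
  ultimately show ?thesis
    unfolding cross_entropy_def softmax_def UNIV_2_eq
    by (simp add: one_hot_model_def axis_def ln_div add_pos_pos add.commute)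
qed

text \<open>The AM-GM inequality for 1 and \<open>exp r\<close>, after taking logarithms. The
  right-hand side is the logistic loss averaged over both labels, and equality holds at
  \<open>r = 0\<close>.\<close>

lemma mean_logistic_loss_ge: "ln (2::real) \<le> (ln (1 + exp r) - r + ln (1 + exp r)) / 2"
proof -
  have "4 * exp r \<le> (1 + exp r)\<^sup>2"
    using zero_le_power2[of "1 - exp r"] by (simp add: power2_eq_square algebra_simps)
  then have "ln (4 * exp r) \<le> ln ((1 + exp r)\<^sup>2)"
    by (subst ln_le_cancel_iff) (auto intro: add_pos_pos)
  moreover have "ln (4 :: real) = 2 * ln 2"
    using ln_realpow[of 2 2] by simp
  ultimately show ?thesis
    by (simp add: ln_mult ln_realpow add_pos_pos)
qed

lemma feature_measurable [measurable]:
  "(feature :: real^'d::finite \<Rightarrow> real^'n::finite) \<in> borel_measurable borel"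
proof -
  have eq: "(feature :: real^'d \<Rightarrow> real^'n) = (\<lambda>x. \<Sum>j\<in>UNIV. hit j x *\<^sub>R axis j 1)"
    by (auto simp: fun_eq_iff vec_eq_iff feature_def axis_def if_distrib cong: if_cong)
  show ?thesis unfolding eq by measurable
qed

text \<open>The fair label is integrated out first, leaving the label-averaged loss as a function of
  the input index.\<close>

lemma risk_one_hot_model:
  fixes \<theta> :: "real^'n::finite"
  shows "risk (one_hot_law TYPE('n) :: 'd::finite example measure) (one_hot_model s) \<theta> =
    (\<integral>\<^sup>+i. ennreal ((ln (1 + exp (2 * sqrt s * (\<theta> \<bullet> feature (one_hot_input i :: real^'d))))
        - 2 * sqrt s * (\<theta> \<bullet> feature (one_hot_input i :: real^'d))
        + ln (1 + exp (2 * sqrt s * (\<theta> \<bullet> feature (one_hot_input i :: real^'d))))) / 2)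
      \<partial>pmf_of_set (UNIV :: 'n option set))"
proof -
  have [measurable]: "Measurable.pred (count_space UNIV) (\<lambda>y. y = (0::2))"
    by simp
  have coin: "(\<integral>\<^sup>+y. ennreal (ln (1 + exp r) - (if y = 0 then r else 0)) \<partial>pmf_of_set (UNIV :: 2 set)) =
    ennreal ((ln (1 + exp r) - r + ln (1 + exp r)) / 2)" for r :: real
  proof -
    \<comment> \<open>Both label losses must be nonnegative for their sum in \<open>ennreal\<close>
      to agree with the real one.\<close>
    have "r = ln (exp r)" by simp
    also have "\<dots> \<le> ln (1 + exp r)" by (subst ln_le_cancel_iff) (auto intro: add_pos_pos)
    finally have "r \<le> ln (1 + exp r)" .
    moreover have "0 \<le> ln (1 + exp r)" by (intro ln_ge_zero) simp
    moreover from calculation have "0 \<le> 2 * ln (1 + exp r) - r" by linarith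
    moreover have "(1 :: 2) \<noteq> 0" by simp
    ultimately show ?thesis
      by (subst nn_integral_pmf_of_set)
        (auto simp: UNIV_2_eq divide_ennreal ennreal_numeral[symmetric] simp flip: ennreal_plus
          simp del: ennreal_numeral)
  qed
  have "risk (one_hot_law TYPE('n) :: 'd example measure) (one_hot_model s) \<theta> =
    (\<integral>\<^sup>+z. ennreal (ln (1 + exp (2 * sqrt s * (\<theta> \<bullet> feature (one_hot_input (fst z) :: real^'d))))
        - (if snd z = 0 then 2 * sqrt s * (\<theta> \<bullet> feature (one_hot_input (fst z) :: real^'d)) else 0))
      \<partial>pair_pmf (pmf_of_set (UNIV :: 'n option set)) (pmf_of_set (UNIV :: 2 set)))"
    unfolding risk_def cross_entropy_one_hot_model one_hot_law_def
    by (subst nn_integral_distr) (auto simp: case_prod_beta space_pair_measure cong: if_cong)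
  then show ?thesis
    unfolding nn_integral_pair_pmf' fst_conv snd_conv coin .
qed

text \<open>Zero is optimal input by input: the label-averaged loss is at least \<open>ln 2\<close>
  everywhere, and the zero parameter attains this bound at every input.\<close>

lemma one_hot_task:
  assumes "s \<ge> 0"
  shows "binary_classification_task (one_hot_law TYPE('n)) (one_hot_model s :: ('d::finite, 'n::finite) model) 0"
proof -
  let ?D = "one_hot_law TYPE('n) :: 'd example measure"
  let ?h = "one_hot_model s :: ('d, 'n) model"
  have risk0: "risk ?D ?h 0 = ennreal (ln 2)"
    by (simp add: risk_one_hot_model)
  moreover have "ennreal (ln 2) \<le> risk ?D ?h \<theta>" for \<theta>
  proof -
    have "ennreal (ln 2) = (\<integral>\<^sup>+i. ennreal (ln 2) \<partial>pmf_of_set (UNIV :: 'n option set))"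
      by simp
    also have "\<dots> \<le> risk ?D ?h \<theta>"
      unfolding risk_one_hot_model by (intro nn_integral_mono ennreal_leI mean_logistic_loss_ge)
    finally show ?thesis .
  qed
  moreover have "(\<lambda>x. ?h x \<theta>) \<in> borel_measurable borel" for \<theta>
    unfolding one_hot_model_def by measurable
  moreover have "?h x differentiable (at \<theta>)" for x \<theta>
    using one_hot_model_has_derivative by (auto simp: differentiable_def)
  moreover have "integrable ?D (\<lambda>z. gauss_newton ?h 0 (fst z))"
    unfolding gauss_newton_one_hot_model[OF assms]
    by (intro integral_diag_mat integrable_hit)
  moreover have "integrable ?D (\<lambda>z. gauss_newton ?h 0 (fst z) ** gauss_newton ?h 0 (fst z))"
    unfolding gauss_newton_one_hot_model[OF assms] diag_mat_mult
    using integrable_hit[of "s * s"]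
    by (intro integral_diag_mat) (simp add: hit_mult_hit mult.assoc mult.left_commute)
  ultimately show ?thesis
    unfolding binary_classification_task_def case_prod_beta
    by (auto simp: prob_space_one_hot_law sets_one_hot_law)
qed

section \<open>Moments of the in-batch matrices\<close>

lemma gn_hessian_one_hot:
  assumes "s \<ge> 0"
  shows "gn_hessian (one_hot_law TYPE('n)) (one_hot_model s :: ('d::finite, 'n::finite) model) 0 =
    mat (s / (real CARD('n) + 1))"
  unfolding gn_hessian_def case_prod_beta gauss_newton_one_hot_model[OF assms]
  by (subst integral_diag_mat(2)) (simp_all add: integrable_hit[of 1, simplified] integral_hit mat_eq_diag_mat)

text \<open>The \<open>j\<close>-th diagonal entry of the in-batch matrix; it is the random variable
  that drives the scalar iteration in coordinate \<open>j\<close>.\<close>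

definition hit_mean :: "real \<Rightarrow> nat \<Rightarrow> 'n::finite \<Rightarrow> (nat \<Rightarrow> 'd::finite example) \<Rightarrow> real" where
  "hit_mean s b j z = (\<Sum>i<b. s * hit j (fst (z i))) / real b"

lemma batch_gn_one_hot_model:
  assumes "s \<ge> 0"
  shows "batch_gn (one_hot_model s) 0 b z = diag_mat (\<lambda>j. hit_mean s b j z)"
  unfolding batch_gn_def gauss_newton_one_hot_model[OF assms] diag_mat_sum scaleR_diag_mat hit_mean_def
  by simp

lemma prob_space_batch:
  "prob_space (batch (one_hot_law TYPE('n::finite)) b :: (nat \<Rightarrow> 'd::finite example) measure)"
  unfolding batch_def by (intro prob_space_PiM prob_space_one_hot_law)

lemma hit_mean_measurable [measurable]:
  "hit_mean s b (j::'n::finite) \<in> borel_measurable (batch (one_hot_law TYPE('n)) b :: (nat \<Rightarrow> 'd::finite example) measure)"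
  unfolding hit_mean_def batch_def by measurable

lemma hit_mean_bounds:
  assumes "s \<ge> 0"
  shows "0 \<le> hit_mean s b j z" "hit_mean s b j z \<le> s"
proof -
  show "0 \<le> hit_mean s b j z"
    unfolding hit_mean_def using assms by (intro divide_nonneg_nonneg sum_nonneg) (auto simp: hit_bounds)
  have "(\<Sum>i<b. s * hit j (fst (z i))) \<le> (\<Sum>i<b. s)"
    using assms by (intro sum_mono mult_left_le) (auto simp: hit_bounds)
  then show "hit_mean s b j z \<le> s"
    unfolding hit_mean_def using assms by (cases "b = 0") (auto simp: field_simps)
qed

lemma hit_mean_moments:
  fixes j :: "'n::finite"
  assumes s: "s \<ge> 0" and b: "b > 0"
  defines "M \<equiv> batch (one_hot_law TYPE('n)) b :: (nat \<Rightarrow> 'd::finite example) measure"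
    and "a \<equiv> s / (real CARD('n) + 1)"
  shows "integrable M (hit_mean s b j)" "integrable M (\<lambda>z. (hit_mean s b j z)\<^sup>2)"
    and "(\<integral>z. hit_mean s b j z \<partial>M) = a"
    and "(\<integral>z. (hit_mean s b j z)\<^sup>2 \<partial>M) = a\<^sup>2 + real CARD('n) * a\<^sup>2 / b"
proof -
  let ?D = "one_hot_law TYPE('n) :: 'd example measure"
  interpret D: prob_space ?D by (rule prob_space_one_hot_law)
  interpret prob_space M unfolding M_def by (rule prob_space_batch)
  have [measurable]: "hit_mean s b j \<in> borel_measurable M"
    unfolding M_def by measurable
  show "integrable M (hit_mean s b j)"
    by (intro integrable_const_bound[where B = s]) (simp_all add: hit_mean_bounds[OF s])
  show "integrable M (\<lambda>z. (hit_mean s b j z)\<^sup>2)"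
    by (intro integrable_const_bound[where B = "s\<^sup>2"]) (simp_all add: hit_mean_bounds[OF s] power_mono)
  \<comment> \<open>Each example of the batch has the data law, so moments transfer along the
    coordinate maps.\<close>
  have comp: "integrable M (\<lambda>z. f (z i)) \<and> expectation (\<lambda>z. f (z i)) = D.expectation f"
    if "i < b" "integrable ?D f" for f :: "'d example \<Rightarrow> real" and i
  proof -
    have "distr M ?D (\<lambda>z. z i) = ?D"
      unfolding M_def batch_def using that by (intro distr_PiM_component prob_space_one_hot_law) auto
    moreover have "(\<lambda>z. z i) \<in> M \<rightarrow>\<^sub>M ?D"
      unfolding M_def batch_def using that by (intro measurable_component_singleton) auto
    ultimately show ?thesis
      using integrable_distr[of "\<lambda>z. z i" M ?D f] integral_distr[of "\<lambda>z. z i" M ?D f] that by auto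
  qed
  \<comment> \<open>As an indicator equals its square, the second moment is \<open>s\<close> times
    the mean.\<close>
  have sq: "(s * hit j x)\<^sup>2 = s\<^sup>2 * hit j x" for x :: "real^'d"
    by (simp add: power_mult_distrib hit_square)
  have mean: "D.expectation (\<lambda>x. s * hit j (fst x)) = a"
    by (simp add: integral_hit a_def)
  have second: "D.expectation (\<lambda>x. (s * hit j (fst x))\<^sup>2) = s * a"
    unfolding sq by (simp add: integral_hit a_def power2_eq_square)
  have "indep_vars (\<lambda>_. borel) (\<lambda>i z. s * hit j (fst (z i))) {..<b}"
    using indep_vars_compose2[OF indep_vars_PiM_components[of "{..<b}" "\<lambda>_. ?D", folded batch_def M_def],
        of "\<lambda>_ x. s * hit j (fst x)" "\<lambda>_. borel"] b D.prob_space_axioms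
    by auto
  from second_moment_mean_iid[OF this, of a "s * a"]
  have "expectation (\<lambda>z. (hit_mean s b j z)\<^sup>2) = a\<^sup>2 + (s * a - a\<^sup>2) / b"
    unfolding hit_mean_def
    using b mean second comp[of _ "\<lambda>x. s * hit j (fst x)"] comp[of _ "\<lambda>x. (s * hit j (fst x))\<^sup>2"]
      integrable_hit[of s j, where 'd = 'd] integrable_hit[of "s\<^sup>2" j, where 'd = 'd]
    by (simp add: sq)
  \<comment> \<open>The count of \<open>N + 1\<close> inputs pays off here: \<open>s\<close> is
    \<open>N + 1\<close> times \<open>a\<close>, so subtracting the squared mean leaves exactly the
    trace \<open>N * a\<close> times \<open>a\<close>.\<close>
  also have "s * a - a\<^sup>2 = real CARD('n) * a\<^sup>2"
  proof -
    have "s = a * (real CARD('n) + 1)" by (simp add: a_def)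
    then show ?thesis by (simp add: power2_eq_square algebra_simps)
  qed
  finally show "expectation (\<lambda>z. (hit_mean s b j z)\<^sup>2) = a\<^sup>2 + real CARD('n) * a\<^sup>2 / b" .
  have "expectation (hit_mean s b j) = (\<Sum>i<b. expectation (\<lambda>z. s * hit j (fst (z i)))) / b"
    unfolding hit_mean_def
    using comp[of _ "\<lambda>x. s * hit j (fst x)"] integrable_hit[of s j, where 'd = 'd]
    by (subst Bochner_Integration.integral_divide_zero, subst Bochner_Integration.integral_sum) auto
  also have "\<dots> = (\<Sum>i<b. a) / b"
    using comp[of _ "\<lambda>x. s * hit j (fst x)"] integrable_hit[of s j, where 'd = 'd] mean
    by (intro arg_cong2[of _ _ _ _ "(/)"] sum.cong) auto
  finally show "expectation (hit_mean s b j) = a" using b by simp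
qed

lemma batch_gn_var_one_hot:
  fixes s :: real
  assumes "s \<ge> 0" "b > 0"
  defines "a \<equiv> s / (real CARD('n) + 1)"
  shows "batch_gn_var (one_hot_law TYPE('n)) (one_hot_model s :: ('d::finite, 'n::finite) model) 0 b =
    mat (real CARD('n) * a\<^sup>2 / b)"
proof -
  let ?M = "batch (one_hot_law TYPE('n)) b :: (nat \<Rightarrow> 'd::finite example) measure"
  have "(\<integral>z. diag_mat (\<lambda>j. (hit_mean s b j z)\<^sup>2) \<partial>?M) =
    (mat (a\<^sup>2 + real CARD('n) * a\<^sup>2 / b) :: real^'n^'n)"
    using hit_mean_moments[OF assms(1,2), where 'n = 'n and 'd = 'd]
    by (subst integral_diag_mat(2)) (simp_all add: mat_eq_diag_mat a_def)
  then show ?thesis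
    unfolding batch_gn_var_def batch_gn_one_hot_model[OF assms(1)] diag_mat_mult
      power2_eq_square[of "hit_mean _ _ _ _", symmetric] gn_hessian_one_hot[OF assms(1)] a_def[symmetric]
    by (simp add: mat_algebra power2_eq_square)
qed

section \<open>Divergence of LiSSA on the one-hot task\<close>

lemma lissa_diag_mat_error:
  "lissa (\<lambda>s. diag_mat (v s)) lam \<eta> u0 ((a + lam) *\<^sub>R 1) t $ j - 1 =
     lissa_error a lam \<eta> (\<lambda>s. v s j) (u0 $ j - 1) t"
  for v :: "nat \<Rightarrow> 'n::finite \<Rightarrow> real"
proof (induction t)
  case (Suc t)
  \<comment> \<open>With a coordinate of the iterate written as 1 plus the error, the gradient is
    \<open>x + lam\<close> times the error plus \<open>x - a\<close>, where \<open>x\<close> is the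
    current diagonal entry.\<close>
  show ?case
    unfolding lissa_error.simps Suc[symmetric]
    by (simp add: mat_algebra diag_mat_vector_mult algebra_simps)
qed simp

text \<open>Coordinates may depend on each other through the shared batch, but the scalar results
  need only independence across steps. The mean is treated coordinatewise, and the squared norm is
  bounded below by a single coordinate.\<close>

lemma lissa_one_hot:
  fixes s lam \<eta> :: real and b :: nat
  assumes s: "s > 0" and b: "b > 0"
  defines "a \<equiv> s / (real CARD('n) + 1)"
    and "h \<equiv> one_hot_model s :: ('d::finite, 'n::finite) model"
    and "M \<equiv> batch_stream (one_hot_law TYPE('n)) b :: (nat \<Rightarrow> nat \<Rightarrow> 'd example) measure"
  assumes contr: "\<bar>1 - \<eta> * (a + lam)\<bar> < 1" and \<eta>: "\<eta> \<noteq> 0"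
    and grow: "(1 - \<eta> * (a + lam))\<^sup>2 + \<eta>\<^sup>2 * (real CARD('n) * a\<^sup>2 / b) \<ge> 1"
  shows "(\<lambda>t. norm ((\<integral>\<omega>. lissa_iterate h 0 b lam \<eta> u0 ((a + lam) *\<^sub>R 1) t \<omega> \<partial>M) - 1)) \<longlonglongrightarrow> 0"
    and "filterlim (\<lambda>t. \<integral>\<omega>. (norm (lissa_iterate h 0 b lam \<eta> u0 ((a + lam) *\<^sub>R 1) t \<omega> - 1))\<^sup>2 \<partial>M)
      at_top sequentially"
proof -
  let ?B = "batch (one_hot_law TYPE('n)) b :: (nat \<Rightarrow> 'd example) measure"
  let ?v = "real CARD('n) * a\<^sup>2 / b"
  let ?X = "\<lambda>j i (\<omega> :: nat \<Rightarrow> nat \<Rightarrow> 'd example). hit_mean s b (j :: 'n) (\<omega> i)"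
  define u where "u = lissa_iterate h 0 b lam \<eta> u0 ((a + lam) *\<^sub>R 1)"
  let ?err = "\<lambda>j t \<omega>. lissa_error a lam \<eta> (\<lambda>i. ?X j i \<omega>) (u0 $ j - 1) t"
  interpret prob_space M
    unfolding M_def batch_stream_def by (intro prob_space_PiM prob_space_batch)
  have err: "u t \<omega> $ j - 1 = ?err j t \<omega>" for t \<omega> j
    unfolding u_def h_def lissa_iterate_def using s
    by (subst batch_gn_one_hot_model) (auto simp: lissa_diag_mat_error)
  have law: "distr M ?B (\<lambda>\<omega>. \<omega> i) = ?B" for i
    unfolding M_def batch_stream_def by (intro distr_PiM_component prob_space_batch) auto
  have comp [measurable]: "(\<lambda>\<omega>. \<omega> i) \<in> M \<rightarrow>\<^sub>M ?B" for i
    unfolding M_def batch_stream_def by measurable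
  have ind: "indep_vars (\<lambda>_. borel) (?X j) UNIV" for j
    using indep_vars_compose2[OF indep_vars_PiM_components[of "UNIV :: nat set" "\<lambda>_. ?B", folded batch_stream_def M_def],
        of "\<lambda>_. hit_mean s b j" "\<lambda>_. borel"] prob_space_batch[of b, where 'n = 'n and 'd = 'd]
    by auto
  note mom = hit_mean_moments[of s b, where 'n = 'n and 'd = 'd, folded a_def]
  have int: "integrable M (?X j i)" "integrable M (\<lambda>\<omega>. (?X j i \<omega>)\<^sup>2)" for i j
    using s b law[of i] mom(1,2)[of j] integrable_distr[OF comp[of i], of "hit_mean s b j"]
      integrable_distr[OF comp[of i], of "\<lambda>z. (hit_mean s b j z)\<^sup>2"] by auto
  have mean: "expectation (?X j i) = a" for i j
    using s b law[of i] mom(3)[of j] integral_distr[OF comp[of i], of "hit_mean s b j"] by simp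
  have second: "expectation (\<lambda>\<omega>. (?X j i \<omega>)\<^sup>2) = a\<^sup>2 + ?v" for i j
    using s b law[of i] mom(4)[of j] integral_distr[OF comp[of i], of "\<lambda>z. (hit_mean s b j z)\<^sup>2"] by simp
  note err_int = integrable_lissa_error[OF ind int mean second, of lam \<eta>]
  have u_nth: "(\<lambda>\<omega>. u t \<omega> $ j) = (\<lambda>\<omega>. ?err j t \<omega> + 1)" for t j
    using err[of t _ j] by (simp add: fun_eq_iff algebra_simps)
  have u_int: "integrable M (u t)" for t
    by (rule integrable_vecI) (simp add: u_nth err_int)
  have "expectation (u t) - 1 = (1 - \<eta> * (a + lam)) ^ t *\<^sub>R (u0 - 1)" for t
    by (simp add: vec_eq_iff integral_vec_nth u_int u_nth err_int prob_space
        expectation_lissa_error[OF ind int mean second])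
  moreover have "(\<lambda>t. norm ((1 - \<eta> * (a + lam)) ^ t *\<^sub>R (u0 - 1))) \<longlonglongrightarrow> norm (0 *\<^sub>R (u0 - 1))"
    using contr by (intro tendsto_intros LIMSEQ_power_zero) auto
  ultimately show "(\<lambda>t. norm (expectation (lissa_iterate h 0 b lam \<eta> u0 ((a + lam) *\<^sub>R 1) t) - 1)) \<longlonglongrightarrow> 0"
    unfolding u_def[symmetric] by simp
  \<comment> \<open>An index type is nonempty, so some coordinate is available for the lower
    bound.\<close>
  fix j0 :: 'n
  have "a > 0" using s by (simp add: a_def add_pos_pos)
  then have lower: "filterlim (\<lambda>t. expectation (\<lambda>\<omega>. (?err j0 t \<omega>)\<^sup>2)) at_top sequentially"
    using contr \<eta> grow b
    by (intro second_moment_lissa_error_at_top[OF ind int mean second]) auto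
  have le: "expectation (\<lambda>\<omega>. (?err j0 t \<omega>)\<^sup>2) \<le> expectation (\<lambda>\<omega>. (norm (u t \<omega> - 1))\<^sup>2)" for t
  proof -
    have n: "(norm (u t \<omega> - 1))\<^sup>2 = (\<Sum>j\<in>UNIV. (?err j t \<omega>)\<^sup>2)" for \<omega>
      by (simp add: power2_norm_eq_inner inner_vec_def err flip: power2_eq_square)
    show ?thesis
      unfolding n
      by (intro integral_mono Bochner_Integration.integrable_sum err_int member_le_sum) auto
  qed
  show "filterlim (\<lambda>t. expectation (\<lambda>\<omega>. (norm (lissa_iterate h 0 b lam \<eta> u0 ((a + lam) *\<^sub>R 1) t \<omega> - 1))\<^sup>2))
      at_top sequentially"
    unfolding u_def[symmetric] by (rule filterlim_at_top_mono[OF lower always_eventually]) (use le in auto)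
qed

theorem lemma1:
  fixes lam :: real
  assumes "lam > 0"
  shows "\<exists>(D :: 'd::finite example measure) (h :: ('d, 'n::finite) model) \<theta> H.
    binary_classification_task D h \<theta> \<and> H = gn_hessian D h \<theta> \<and> lambda_max H > 0 \<and>
    (\<forall>b\<ge>1. batch_gn_var D h \<theta> b = (1 / real b) *\<^sub>R (trace H *\<^sub>R H)) \<and>
    (\<exists>u0 g. \<forall>b\<ge>1. \<forall>\<eta>.
       0 < \<eta> \<and> \<eta> \<le> 1 / lambda_max H \<and> (\<exists>\<mu>\<ge>1. eigenvalue (msq_matrix D h \<theta> b lam \<eta>) \<mu>) \<longrightarrow>
       (\<lambda>t. norm ((\<integral>\<omega>. lissa_iterate h \<theta> b lam \<eta> u0 g t \<omega> \<partial>batch_stream D b) -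
                  lissa_target H lam g)) \<longlonglongrightarrow> 0 \<and>
       filterlim (\<lambda>t. \<integral>\<omega>. (norm (lissa_iterate h \<theta> b lam \<eta> u0 g t \<omega> -
                  lissa_target H lam g))\<^sup>2 \<partial>batch_stream D b) at_top sequentially) \<and>
    (\<forall>b\<ge>1. real b \<le> (lambda_max H / (lambda_max H + lam))\<^sup>2 * (trace H / lambda_max H) \<longrightarrow>
       (\<exists>\<eta>. 0 < \<eta> \<and> \<eta> \<le> 1 / lambda_max H \<and>
            (\<exists>\<mu>\<ge>1. eigenvalue (msq_matrix D h \<theta> b lam \<eta>) \<mu>)))"
proof -
  \<comment> \<open>Chosen so that division by \<open>N + 1\<close> gives
    \<open>a = 2 * lam\<close>.\<close>
  define s where "s = 2 * lam * (real CARD('n) + 1)"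
  define a where "a = 2 * lam"
  let ?D = "one_hot_law TYPE('n) :: 'd example measure"
  let ?h = "one_hot_model s :: ('d, 'n) model"
  let ?H = "mat a :: real^'n^'n"
  have "s > 0" using assms by (simp add: s_def add_pos_pos)
  then have "s \<ge> 0" by simp
  have "real CARD('n) + 1 \<noteq> 0" using of_nat_0_le_iff[of "CARD('n)", where 'a = real] by linarith
  then have a: "s / (real CARD('n) + 1) = a" by (simp add: s_def a_def)
  have "a > 0" using assms by (simp add: a_def)
  have H: "?H = gn_hessian ?D ?h 0"
    by (simp add: gn_hessian_one_hot[OF \<open>s \<ge> 0\<close>] a)
  have var: "batch_gn_var ?D ?h 0 b = mat (real CARD('n) * a\<^sup>2 / b)" if "b \<ge> 1" for b
    using that by (subst batch_gn_var_one_hot) (auto simp: \<open>s \<ge> 0\<close> a)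
  have msq: "msq_matrix ?D ?h 0 b lam \<eta> =
      mat ((1 - \<eta> * (a + lam))\<^sup>2 + \<eta>\<^sup>2 * (real CARD('n) * a\<^sup>2 / b))" if "b \<ge> 1" for b \<eta>
    unfolding msq_matrix_def H[symmetric] var[OF that]
    by (simp add: mat_algebra power2_eq_square)
  have target: "lissa_target ?H lam ((a + lam) *\<^sub>R 1) = 1"
    using assms \<open>a > 0\<close> by (intro lissa_target_mat) simp
  \<comment> \<open>The largest step \<open>1 / a\<close> gives
    \<open>\<eta> * (a + lam) = 1 + lam / a\<close>, which is 3/2 and hence below 2.\<close>
  have contr: "\<bar>1 - \<eta> * (a + lam)\<bar> < 1" if "0 < \<eta>" "\<eta> \<le> 1 / a" for \<eta>
  proof -
    have "\<eta> * (a + lam) \<le> 1 / a * (a + lam)"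
      using that assms \<open>a > 0\<close> by (intro mult_right_mono) auto
    also have "\<dots> = 3 / 2" using assms by (simp add: a_def field_simps)
    finally show ?thesis
      using mult_pos_pos[OF that(1), of "a + lam"] assms \<open>a > 0\<close> by auto
  qed
  \<comment> \<open>The witness is the largest step \<open>\<eta> = 1 / a\<close>, for which the
    noise term alone is \<open>N / b\<close>. The trace over \<open>a\<close> is \<open>N\<close>
    and the squared ratio is at most 1, so the batch condition gives
    \<open>b \<le> N\<close>.\<close>
  have small_batch: "1 \<le> (1 - 1 / a * (a + lam))\<^sup>2 + (1 / a)\<^sup>2 * (real CARD('n) * a\<^sup>2 / b)"
    if "b \<ge> 1" "real b \<le> (a / (a + lam))\<^sup>2 * (trace ?H / a)" for b
  proof -
    have "(a / (a + lam))\<^sup>2 \<le> 1"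
      using assms \<open>a > 0\<close> by (intro power_le_one) auto
    have "real b \<le> (a / (a + lam))\<^sup>2 * real CARD('n)"
      using that(2) \<open>a > 0\<close> by (simp add: trace_mat)
    also have "\<dots> \<le> 1 * real CARD('n)"
      using \<open>(a / (a + lam))\<^sup>2 \<le> 1\<close> by (rule mult_right_mono) simp
    finally have "real b \<le> real CARD('n)" by simp
    then have "1 \<le> real CARD('n) / b" using that by (simp add: field_simps)
    moreover have "(1 / a)\<^sup>2 * (real CARD('n) * a\<^sup>2 / b) = real CARD('n) / b"
      using \<open>a > 0\<close> by (simp add: field_simps)
    ultimately show ?thesis by (metis add_increasing zero_le_power2)
  qed
  \<comment> \<open>The iteration starts at 0, and \<open>g\<close> is \<open>a + lam\<close> times
    the all-ones vector, so the target is all ones and the noise persists at the target.\<close>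
  note conv = lissa_one_hot[OF \<open>s > 0\<close>, where 'n = 'n and 'd = 'd, unfolded a, of _ _ lam 0]
  show ?thesis
  proof (intro exI conjI)
    show "binary_classification_task ?D ?h 0" by (rule one_hot_task[OF \<open>s \<ge> 0\<close>])
    show "?H = gn_hessian ?D ?h 0" by (rule H)
    show "lambda_max ?H > 0" by (simp add: lambda_max_mat \<open>a > 0\<close>)
    show "\<forall>b\<ge>1. batch_gn_var ?D ?h 0 b = (1 / real b) *\<^sub>R (trace ?H *\<^sub>R ?H)"
      unfolding trace_mat using var by (simp add: mat_algebra power2_eq_square mult.assoc)
    show "\<forall>b\<ge>1. \<forall>\<eta>. 0 < \<eta> \<and> \<eta> \<le> 1 / lambda_max ?H \<and>
         (\<exists>\<mu>\<ge>1. eigenvalue (msq_matrix ?D ?h 0 b lam \<eta>) \<mu>) \<longrightarrow>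
       (\<lambda>t. norm ((\<integral>\<omega>. lissa_iterate ?h 0 b lam \<eta> 0 ((a + lam) *\<^sub>R 1) t \<omega> \<partial>batch_stream ?D b) -
                  lissa_target ?H lam ((a + lam) *\<^sub>R 1))) \<longlonglongrightarrow> 0 \<and>
       filterlim (\<lambda>t. \<integral>\<omega>. (norm (lissa_iterate ?h 0 b lam \<eta> 0 ((a + lam) *\<^sub>R 1) t \<omega> -
                  lissa_target ?H lam ((a + lam) *\<^sub>R 1)))\<^sup>2 \<partial>batch_stream ?D b) at_top sequentially"
      unfolding target lambda_max_mat
      using contr conv by (auto simp: msq eigenvalue_mat_iff)
    show "\<forall>b\<ge>1. real b \<le> (lambda_max ?H / (lambda_max ?H + lam))\<^sup>2 * (trace ?H / lambda_max ?H) \<longrightarrow>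
       (\<exists>\<eta>. 0 < \<eta> \<and> \<eta> \<le> 1 / lambda_max ?H \<and>
            (\<exists>\<mu>\<ge>1. eigenvalue (msq_matrix ?D ?h 0 b lam \<eta>) \<mu>))"
      using small_batch \<open>a > 0\<close>
      by (auto simp: lambda_max_mat eigenvalue_mat_iff msq intro!: exI[of _ "1 / a"])
  qed
qed

end
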